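(* Let $(X,d,\succcurlyeq)$ be a partially ordered metric space. Then $(X,d,\succcurlyeq)$ has the monotone Lipschitz extension property if and only if it is radial.
   Context: A partially ordered metric space is a triple $(X,d,\succcurlyeq)$ where $X$ is a nonempty set, $(X,d)$ is a metric space and $\succcurlyeq$ is a partial order (reflexive, antisymmetric, transitive) on $X$; no compatibility between $d$ and $\succcurlyeq$ is assumed. Write $x\succ y$ if $x\succcurlyeq y$ and $x\neq y$, and write $x\succcurlyeq^{\bullet}y$ if it is not the case that $y\succcurlyeq x$. $(X,d,\succcurlyeq)$ is radial if for all $x,y,z\in X$: (i) $x\succcurlyeq^{\bullet}y\succ z$ implies $d(x,z)\ge d(x,y)$; and (ii) $x\succ y\succcurlyeq^{\bullet}z$ implies $d(x,z)\ge d(y,z)$. For $S\subseteq X$ and $K>0$, $\mathrm{Lip}_{K,\uparrow}(S)$ is the set of all functions $f:S\to\mathbb{R}$ that are $K$-Lipschitz ($|f(x)-f(y)|\le K d(x,y)$ for all $x,y\in S$) and $\succcurlyeq$-increasing ($f(x)\ge f(y)$ for all $x,y\in S$ with $x\succcurlyeq y$). $(X,d,\succcurlyeq)$ has the monotone Lipschitz extension property if for every nonempty $S\subseteq X$, every $K>0$ and every $f\in\mathrm{Lip}_{K,\uparrow}(S)$, there exists $F\in\mathrm{Lip}_{K,\uparrow}(X)$ with $F|_{S}=f$. *)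

theory Defs
  imports "HOL-Analysis.Abstract_Metric_Spaces"
begin

locale partially_ordered_metric_space = Metric_space X d
  for X :: "'a set" and d :: "'a \<Rightarrow> 'a \<Rightarrow> real" +
  fixes geq :: "'a \<Rightarrow> 'a \<Rightarrow> bool" (infix "\<succcurlyeq>" 50)
  assumes nonempty: "X \<noteq> {}"
    and refl_geq: "reflp_on X (\<succcurlyeq>)"
    and antisym_geq: "antisymp_on X (\<succcurlyeq>)"
    and trans_geq: "transp_on X (\<succcurlyeq>)"

definition strictly_above :: "('a \<Rightarrow> 'a \<Rightarrow> bool) \<Rightarrow> 'a \<Rightarrow> 'a \<Rightarrow> bool" where
  "strictly_above geq x y \<longleftrightarrow> geq x y \<and> x \<noteq> y"

(* The order is partial, so incomparable elements satisfy not_below in both directions. *)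
definition not_below :: "('a \<Rightarrow> 'a \<Rightarrow> bool) \<Rightarrow> 'a \<Rightarrow> 'a \<Rightarrow> bool" where
  "not_below geq x y \<longleftrightarrow> \<not> geq y x"

definition radial :: "'a set \<Rightarrow> ('a \<Rightarrow> 'a \<Rightarrow> real) \<Rightarrow> ('a \<Rightarrow> 'a \<Rightarrow> bool) \<Rightarrow> bool" where
  "radial X d geq \<longleftrightarrow>
     (\<forall>x\<in>X. \<forall>y\<in>X. \<forall>z\<in>X.
        (not_below geq x y \<and> strictly_above geq y z \<longrightarrow> d x z \<ge> d x y) \<and>
        (strictly_above geq x y \<and> not_below geq y z \<longrightarrow> d x z \<ge> d y z))"

(* A real function on S is represented by any total function with the right values on S;
   values outside S are unconstrained. *)
definition Lip_incr ::
    "('a \<Rightarrow> 'a \<Rightarrow> real) \<Rightarrow> ('a \<Rightarrow> 'a \<Rightarrow> bool) \<Rightarrow> real \<Rightarrow> 'a set \<Rightarrow> ('a \<Rightarrow> real) set" where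
  "Lip_incr d geq K S =
     {f. (\<forall>x\<in>S. \<forall>y\<in>S. \<bar>f x - f y\<bar> \<le> K * d x y) \<and> monotone_on S geq (\<ge>) f}"

definition monotone_Lipschitz_extension_property ::
    "'a set \<Rightarrow> ('a \<Rightarrow> 'a \<Rightarrow> real) \<Rightarrow> ('a \<Rightarrow> 'a \<Rightarrow> bool) \<Rightarrow> bool" where
  "monotone_Lipschitz_extension_property X d geq \<longleftrightarrow>
     (\<forall>S K f. S \<subseteq> X \<and> S \<noteq> {} \<and> K > 0 \<and> f \<in> Lip_incr d geq K S \<longrightarrow>
        (\<exists>F \<in> Lip_incr d geq K X. \<forall>x\<in>S. F x = f x))"

end

theory Submission
  imports Defs
begin

text \<open>
  Necessity is a test on two points. If \<open>p\<close> is not below \<open>q\<close>, the function that takes the value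
  \<open>d p q\<close> at \<open>p\<close> and \<open>0\<close> at \<open>q\<close> is increasing and 1-Lipschitz on \<open>{p, q}\<close>. An increasing
  extension can only become smaller at a point below \<open>q\<close> and only larger at a point above \<open>p\<close>,
  so the Lipschitz condition forces such points to be at least \<open>d p q\<close> away from the other
  point. These are exactly the two halves of radiality.

  Sufficiency has an explicit extension, with no transfinite one-point-at-a-time construction.
  The McShane formula \<open>F x = (SUP y\<in>S. f y - K * d x y)\<close> ignores the order. Monotonicity
  demands in addition that \<open>F x \<ge> f y\<close> whenever \<open>x \<succcurlyeq> y\<close>, so the distance is
  replaced by the \<^emph>\<open>deficit\<close>, which vanishes for \<open>x \<succcurlyeq> y\<close> and equals \<open>d x y\<close>
  otherwise. The formula then gives the smallest conceivable extension, and it works because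
  radiality makes the deficit behave like a distance: the first half of radiality says that the
  deficit is antitone in \<open>x\<close> (\<open>deficit_antitone\<close>), which makes \<open>F\<close> increasing, and the
  second half gives the triangle inequality in \<open>x\<close> (\<open>deficit_triangle\<close>), which makes \<open>F\<close>
  finite and \<open>K\<close>-Lipschitz.
\<close>

context partially_ordered_metric_space
begin

lemma geq_refl: "x \<in> X \<Longrightarrow> x \<succcurlyeq> x"
  using refl_geq by (rule reflp_onD)

lemma geq_trans: "\<lbrakk>x \<in> X; y \<in> X; z \<in> X; x \<succcurlyeq> y; y \<succcurlyeq> z\<rbrakk> \<Longrightarrow> x \<succcurlyeq> z"
  using trans_geq by (meson transp_onD)

lemma two_point_extension:
  assumes ext: "monotone_Lipschitz_extension_property X d (\<succcurlyeq>)"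
    and pq: "p \<in> X" "q \<in> X" "\<not> q \<succcurlyeq> p"
  obtains F where "F \<in> Lip_incr d (\<succcurlyeq>) 1 X" "F p = d p q" "F q = 0"
proof -
  define f where "f = (\<lambda>u. if u = p then d p q else 0)"
  have "p \<noteq> q"
    using pq geq_refl by auto
  have "f \<in> Lip_incr d (\<succcurlyeq>) 1 {p, q}"
    using pq \<open>p \<noteq> q\<close> by (auto simp: f_def Lip_incr_def monotone_on_def commute)
  then obtain F where F: "F \<in> Lip_incr d (\<succcurlyeq>) 1 X" "\<forall>u\<in>{p, q}. F u = f u"
    using ext pq unfolding monotone_Lipschitz_extension_property_def
    by (metis empty_subsetI insert_not_empty insert_subset zero_less_one)
  show thesis
    by (rule that[of F]) (use F \<open>p \<noteq> q\<close> in \<open>auto simp: f_def\<close>)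
qed

lemma extension_property_imp_radial:
  assumes ext: "monotone_Lipschitz_extension_property X d (\<succcurlyeq>)"
  shows "radial X d (\<succcurlyeq>)"
  unfolding radial_def not_below_def strictly_above_def
proof (intro ballI conjI impI)
  fix x y z assume X: "x \<in> X" "y \<in> X" "z \<in> X"
  {
    assume h: "\<not> y \<succcurlyeq> x \<and> y \<succcurlyeq> z \<and> y \<noteq> z"
    then obtain F where F: "F \<in> Lip_incr d (\<succcurlyeq>) 1 X" "F x = d x y" "F y = 0"
      using two_point_extension[OF ext] X by metis
    have "F z \<le> F y" "\<bar>F x - F z\<bar> \<le> 1 * d x z"
      using F(1) X h unfolding Lip_incr_def monotone_on_def by blast+
    then show "d x z \<ge> d x y"
      using F by simp
  next
    assume h: "(x \<succcurlyeq> y \<and> x \<noteq> y) \<and> \<not> z \<succcurlyeq> y"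
    then obtain F where F: "F \<in> Lip_incr d (\<succcurlyeq>) 1 X" "F y = d y z" "F z = 0"
      using two_point_extension[OF ext] X by metis
    have "F y \<le> F x" "\<bar>F x - F z\<bar> \<le> 1 * d x z"
      using F(1) X h unfolding Lip_incr_def monotone_on_def by blast+
    then show "d x z \<ge> d y z"
      using F by simp
  }
qed

text \<open>
  The price, per unit of the Lipschitz constant, by which an increasing function may be smaller
  at \<open>x\<close> than at \<open>y\<close>.
\<close>

definition deficit :: "'a \<Rightarrow> 'a \<Rightarrow> real" where
  "deficit x y = (if x \<succcurlyeq> y then 0 else d x y)"

lemma deficit_nonneg: "0 \<le> deficit x y"
  by (simp add: deficit_def)

lemma Lip_incr_deficit:
  assumes "f \<in> Lip_incr d (\<succcurlyeq>) K S" "x \<in> S" "y \<in> S"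
  shows "f y - K * deficit x y \<le> f x"
proof (cases "x \<succcurlyeq> y")
  case True
  then show ?thesis
    using assms by (auto simp: deficit_def Lip_incr_def monotone_on_def)
next
  case False
  have "\<bar>f x - f y\<bar> \<le> K * d x y"
    using assms by (auto simp: Lip_incr_def)
  then show ?thesis
    using False by (simp add: deficit_def)
qed

text \<open>
  Only the case in which \<open>y\<close> is below neither point is in question. There \<open>y\<close>, \<open>x\<close>, \<open>x'\<close> form the
  configuration of the first half of radiality: going down from \<open>x\<close> to \<open>x'\<close> leads away from \<open>y\<close>.
\<close>

lemma deficit_antitone:
  assumes rad: "radial X d (\<succcurlyeq>)"
    and X: "x \<in> X" "x' \<in> X" "y \<in> X" and "x \<succcurlyeq> x'"
  shows "deficit x y \<le> deficit x' y"
proof (cases "x \<succcurlyeq> y \<or> x = x'")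
  case True
  then show ?thesis
    using deficit_nonneg by (auto simp: deficit_def)
next
  case False
  then have "\<not> x' \<succcurlyeq> y"
    using geq_trans X \<open>x \<succcurlyeq> x'\<close> by blast
  moreover have "d y x' \<ge> d y x"
    using rad X False \<open>x \<succcurlyeq> x'\<close>
    unfolding radial_def not_below_def strictly_above_def by blast
  ultimately show ?thesis
    using False by (simp add: deficit_def commute)
qed

text \<open>
  The triangle inequality of \<open>d\<close> is of no help when \<open>x \<succcurlyeq> y\<close> but not \<open>x' \<succcurlyeq> y\<close>, since
  the deficit at \<open>x\<close> is then \<open>0\<close>. In this case the second half of radiality, applied to \<open>x\<close>, \<open>y\<close>, \<open>x'\<close>,
  says that \<open>x'\<close> is at least as far from \<open>x\<close> as from \<open>y\<close>.
\<close>

lemma deficit_triangle: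
  assumes rad: "radial X d (\<succcurlyeq>)"
    and X: "x \<in> X" "x' \<in> X" "y \<in> X"
  shows "deficit x' y \<le> deficit x y + d x x'"
proof (cases "x' \<succcurlyeq> y")
  case True
  then show ?thesis
    using deficit_nonneg[of x y] nonneg[of x x'] by (simp add: deficit_def)
next
  case x': False
  show ?thesis
  proof (cases "x \<succcurlyeq> y")
    case True
    have "d x x' \<ge> d y x'"
    proof (cases "x = y")
      case False
      then show ?thesis
        using rad X x' True
        unfolding radial_def not_below_def strictly_above_def by blast
    qed simp
    then show ?thesis
      using x' True by (simp add: deficit_def commute)
  next
    case False
    then show ?thesis
      using x' triangle[of x' x y] X by (simp add: deficit_def commute)
  qed
qed

lemma radial_imp_extension_property:
  assumes rad: "radial X d (\<succcurlyeq>)"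
  shows "monotone_Lipschitz_extension_property X d (\<succcurlyeq>)"
  unfolding monotone_Lipschitz_extension_property_def
proof (intro allI impI)
  fix S K f
  assume "S \<subseteq> X \<and> S \<noteq> {} \<and> K > 0 \<and> f \<in> Lip_incr d (\<succcurlyeq>) K S"
  then have S: "S \<subseteq> X" "S \<noteq> {}" and K: "K > 0" and f: "f \<in> Lip_incr d (\<succcurlyeq>) K S"
    by auto
  define F where "F x = (SUP y\<in>S. f y - K * deficit x y)" for x
  \<comment> \<open>Comparing with any fixed point of \<open>S\<close> shows that the supremum is finite.\<close>
  have bdd: "bdd_above ((\<lambda>y. f y - K * deficit x y) ` S)" if x: "x \<in> X" for x
  proof -
    obtain s where s: "s \<in> S"
      using S by auto
    have "f y - K * deficit x y \<le> f s + K * d x s" if y: "y \<in> S" for y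
    proof -
      have "K * deficit s y \<le> K * (deficit x y + d x s)"
        using deficit_triangle[OF rad x, of s y] S s y K by (intro mult_left_mono) auto
      then show ?thesis
        using Lip_incr_deficit[OF f s y] by (simp add: distrib_left)
    qed
    then show ?thesis
      by (auto intro!: bdd_aboveI2)
  qed
  have lower: "f y - K * deficit x y \<le> F x" if "x \<in> X" "y \<in> S" for x y
    unfolding F_def by (rule cSUP_upper[OF \<open>y \<in> S\<close> bdd[OF \<open>x \<in> X\<close>]])
  have least: "F x \<le> c" if "\<And>y. y \<in> S \<Longrightarrow> f y - K * deficit x y \<le> c" for x c
    unfolding F_def using S that by (intro cSUP_least) auto
  have one_sided: "F x \<le> F x' + K * d x x'" if x: "x \<in> X" "x' \<in> X" for x x'
  proof (rule least)
    fix y assume y: "y \<in> S"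
    have "K * deficit x' y \<le> K * (deficit x y + d x x')"
      using deficit_triangle[OF rad x, of y] S y K by (intro mult_left_mono) auto
    then show "f y - K * deficit x y \<le> F x' + K * d x x'"
      using lower[OF x(2) y] by (simp add: distrib_left)
  qed
  have lip: "\<bar>F x - F x'\<bar> \<le> K * d x x'" if "x \<in> X" "x' \<in> X" for x x'
    using one_sided[of x x'] one_sided[of x' x] that by (simp add: commute abs_le_iff)
  have mono: "F x \<ge> F x'" if x: "x \<in> X" "x' \<in> X" "x \<succcurlyeq> x'" for x x'
  proof (rule least)
    fix y assume y: "y \<in> S"
    have "K * deficit x y \<le> K * deficit x' y"
      using deficit_antitone[OF rad x(1,2) _ x(3), of y] S y K by (intro mult_left_mono) auto
    then show "f y - K * deficit x' y \<le> F x"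
      using lower[OF x(1) y] by simp
  qed
  have "F s = f s" if s: "s \<in> S" for s
  proof (rule antisym)
    show "F s \<le> f s"
      using Lip_incr_deficit[OF f s] by (rule least)
    have "s \<in> X"
      using S s by auto
    then have "deficit s s = 0"
      using geq_refl by (simp add: deficit_def)
    then show "f s \<le> F s"
      using lower[OF \<open>s \<in> X\<close> s] by simp
  qed
  moreover have "F \<in> Lip_incr d (\<succcurlyeq>) K X"
    using lip mono by (auto simp: Lip_incr_def monotone_on_def)
  ultimately show "\<exists>F\<in>Lip_incr d (\<succcurlyeq>) K X. \<forall>s\<in>S. F s = f s"
    by blast
qed

end

theorem theorem2:
  fixes X :: "'a set" and d :: "'a \<Rightarrow> 'a \<Rightarrow> real" and geq :: "'a \<Rightarrow> 'a \<Rightarrow> bool"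
  assumes "partially_ordered_metric_space X d geq"
  shows "monotone_Lipschitz_extension_property X d geq \<longleftrightarrow> radial X d geq"
  using partially_ordered_metric_space.extension_property_imp_radial[OF assms]
    partially_ordered_metric_space.radial_imp_extension_property[OF assms]
  by blast

end
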